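(* Let $(X,\preceq)$ be a Hausdorff topological $\wedge$-semilattice. Then the map $x\mapsto x^{\downarrow}$ from $X$ into $\mathcal{C}(X)$, where $\mathcal{C}(X)$ is endowed with the Fell topology, is continuous.
   Context: A Hausdorff topological $\wedge$-semilattice is a poset $(X,\preceq)$ in which the greatest lower bound $x\wedge y$ exists for all $x,y\in X$, where $X$ carries a Hausdorff topology such that $(x,y)\mapsto x\wedge y$ is continuous from $X\times X$ (product topology) into $X$. (In such a poset, $\preceq$ is closed in $X\times X$, so every principal ideal is closed.) For $x\in X$, $x^{\downarrow}:=\{z\in X: z\preceq x\}$. $\mathcal{C}(X)$ is the set of all closed subsets of $X$ (including $\varnothing$). The Fell topology on $\mathcal{C}(X)$ is the topology generated (as a subbase) by all sets $O^{-}:=\{A\in\mathcal{C}(X):A\cap O\neq\varnothing\}$ with $O\subseteq X$ open, and all sets $(X\setminus K)^{+}:=\{A\in\mathcal{C}(X):A\subseteq X\setminus K\}$ with $K\subseteq X$ compact. *)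

theory Defs
  imports "HOL-Analysis.Function_Topology"
begin

definition hit_set :: "'a::topological_space set \<Rightarrow> 'a set set" where
  "hit_set U = {A. closed A \<and> A \<inter> U \<noteq> {}}"

definition miss_set :: "'a::topological_space set \<Rightarrow> 'a set set" where
  "miss_set K = {A. closed A \<and> A \<subseteq> UNIV - K}"

definition fell_topology :: "'a::topological_space set topology" where
  "fell_topology = topology_generated_by
     ({hit_set U | U. open U} \<union> {miss_set K | K. compact K})"

text \<open>The carrier of a topology given by a subbase is the union of the subbase; here it is
  the set of all closed sets, the empty set included, because the empty set is compact.\<close>

lemma topspace_fell_topology: "topspace fell_topology = {A. closed A}"
proof -
  have "\<Union> ({hit_set U | U. open U} \<union> {miss_set K | K. compact K}) = {A::'a set. closed A}"
  proof
    show "{A::'a set. closed A} \<subseteq> \<Union> ({hit_set U | U. open U} \<union> {miss_set K | K. compact K})"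
    proof
      fix A :: "'a set" assume "A \<in> {A. closed A}"
      then have "A \<in> miss_set {}" by (simp add: miss_set_def)
      moreover have "compact ({}::'a set)" by simp
      ultimately show "A \<in> \<Union> ({hit_set U | U. open U} \<union> {miss_set K | K. compact K})"
        by blast
    qed
  qed (auto simp: hit_set_def miss_set_def)
  then show ?thesis
    by (simp add: fell_topology_def topology_generated_by_topspace)
qed

end

theory Submission imports Defs begin

text \<open>Continuity into the Fell topology only has to be tested on the subbase, and the two kinds
  of subbasic sets use the continuity of the meet in different ways.

  The principal ideal of \<open>x\<close> meets an open set \<open>U\<close> exactly when \<open>inf z x \<in> U\<close> for some \<open>z\<close>,
  because every element of the ideal has the form \<open>inf z x\<close>.  So the preimage of \<open>hit_set U\<close> is a
  union of preimages of \<open>U\<close> under the continuous maps \<open>inf z\<close>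
  (lemma \<open>open_principal_ideal_meets\<close>).

  In a Hausdorff topological semilattice the order \<open>k \<le> x \<longleftrightarrow> inf k x = k\<close> is a closed relation, since it is the
  coincidence set of two continuous maps.  Its slices, the principal ideals, are therefore closed,
  as they must be to lie in the Fell space.  If moreover no element of a compact set \<open>K\<close> lies below \<open>x\<close>,
  then \<open>{x} \<times> K\<close> lies in the open complement of this relation, and the tube lemma thickens the
  point \<open>x\<close> to a neighbourhood with the same property
  (lemma \<open>open_principal_ideal_misses_compact\<close>).\<close>

text \<open>A point \<open>z \<in> U\<close> below \<open>x\<close> need not stay below a point near \<open>x\<close>; it is replaced there by
  the moving witness \<open>inf z x\<close>, which remains in \<open>U\<close> for \<open>x\<close> near the original point.  The
  element \<open>z\<close> itself stays fixed, so continuity of the meet in one variable suffices.\<close>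

lemma open_principal_ideal_meets:
  fixes U :: "'a::{topological_space, semilattice_inf} set"
  assumes cont: "\<And>z::'a. continuous_on UNIV (inf z)"
    and U: "open U"
  shows "open {x. {z. z \<le> x} \<inter> U \<noteq> {}}"
proof -
  have "{x. {z. z \<le> x} \<inter> U \<noteq> {}} = (\<Union>z. inf z -` U)"
  proof
    show "{x. {z. z \<le> x} \<inter> U \<noteq> {}} \<subseteq> (\<Union>z. inf z -` U)"
    proof
      fix x assume "x \<in> {x. {z. z \<le> x} \<inter> U \<noteq> {}}"
      then obtain z where "z \<le> x" "z \<in> U" by blast
      then have "inf z x \<in> U" by (simp add: inf_absorb1)
      then show "x \<in> (\<Union>z. inf z -` U)" by blast
    qed
    show "(\<Union>z. inf z -` U) \<subseteq> {x. {z. z \<le> x} \<inter> U \<noteq> {}}"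
    proof
      fix x assume "x \<in> (\<Union>z. inf z -` U)"
      then obtain z where "inf z x \<in> U" by blast
      moreover have "inf z x \<le> x" by simp
      ultimately show "x \<in> {x. {z. z \<le> x} \<inter> U \<noteq> {}}" by blast
    qed
  qed
  moreover have "open (\<Union>z. inf z -` U)"
    using open_vimage[OF U cont] by blast
  ultimately show ?thesis by simp
qed

text \<open>The pairs are written with the larger element first, so that the slices over \<open>x\<close> are the
  principal ideals.  Closedness is where the Hausdorff property enters.\<close>

lemma closed_le_relation:
  assumes "continuous_on UNIV (\<lambda>(x, y). inf x y :: 'a::{t2_space, semilattice_inf})"
  shows "closed {(x::'a, y). y \<le> x}"
proof -
  have "continuous_on UNIV (\<lambda>p::'a \<times> 'a. inf (fst p) (snd p))"
    using assms by (simp add: case_prod_beta')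
  then have "closed {p::'a \<times> 'a. inf (fst p) (snd p) = snd p}"
    by (intro closed_Collect_eq continuous_on_snd continuous_on_id)
  moreover have "{p::'a \<times> 'a. inf (fst p) (snd p) = snd p} = {(x, y). y \<le> x}"
    by (auto simp: le_iff_inf inf_commute)
  ultimately show ?thesis by simp
qed

text \<open>The points \<open>x\<close> excluded here form the projection of a closed subset of \<open>UNIV \<times> K\<close> along the
  compact factor \<open>K\<close>, and such projections are closed.\<close>

lemma open_principal_ideal_misses_compact:
  fixes K :: "'a::{topological_space, ord} set"
  assumes closed_le: "closed {(x::'a, y). y \<le> x}"
    and K: "compact K"
  shows "open {x. {z. z \<le> x} \<subseteq> UNIV - K}"
proof (rule openI)
  fix x assume "x \<in> {x. {z. z \<le> x} \<subseteq> UNIV - K}"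
  then have sub: "{x} \<times> K \<subseteq> - {(x, y). y \<le> x}" by auto
  obtain V where "x \<in> V" "open V" and V: "V \<times> K \<subseteq> - {(x, y). y \<le> x}"
    using tube_lemma[OF K open_Compl[OF closed_le] sub] by (elim exE conjE)
  moreover have "V \<subseteq> {x. {z. z \<le> x} \<subseteq> UNIV - K}"
    using V by auto
  ultimately show "\<exists>T. open T \<and> x \<in> T \<and> T \<subseteq> {x. {z. z \<le> x} \<subseteq> UNIV - K}"
    by blast
qed

theorem theorem6:
  assumes "continuous_on UNIV (\<lambda>(x, y). inf x y :: 'a::{t2_space, semilattice_inf})"
  shows "continuous_map euclidean fell_topology (\<lambda>x::'a. {z. z \<le> x})"
proof -
  let ?ideal = "\<lambda>x::'a. {z. z \<le> x}"
  have cont: "continuous_on UNIV (inf z)" for z :: 'a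
    using continuous_on_compose2[OF assms, of UNIV "Pair z"]
    by (simp add: continuous_on_Pair continuous_on_const continuous_on_id)
  have closed_le: "closed {(x::'a, y). y \<le> x}"
    using assms by (rule closed_le_relation)
  have closed_ideal: "closed (?ideal x)" for x
  proof -
    have "continuous_on UNIV (Pair x)"
      by (intro continuous_on_Pair continuous_on_const continuous_on_id)
    then have "closed (Pair x -` {(x, y). y \<le> x})"
      by (rule closed_vimage[OF closed_le])
    then show ?thesis by simp
  qed
  have hit: "open (?ideal -` hit_set U)" if "open U" for U
    using open_principal_ideal_meets[OF cont that] closed_ideal
    by (simp add: hit_set_def vimage_def)
  have miss: "open (?ideal -` miss_set K)" if "compact K" for K
    using open_principal_ideal_misses_compact[OF closed_le that] closed_ideal
    by (simp add: miss_set_def vimage_def)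
  have "?ideal ` topspace euclidean \<subseteq> topspace fell_topology"
    using closed_ideal by (auto simp: topspace_fell_topology)
  then show ?thesis
    unfolding fell_topology_def continuous_on_generated_topo_iff topology_generated_by_topspace
    using hit miss by simp blast
qed

end
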